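(* Let $n\ge2$, $\lambda\in\mathbb{R}$, let $\mu$ be a positive Borel measure on $S^{n-1}$, and let $U$ be the potential function defined in $B^n$ by $$U(x)=\int_{S^{n-1}}\frac{1}{|x-\eta|^{n+2\lambda}}\,d\mu(\eta),$$ assumed finite for $x\in B^n$. Let $\zeta\in S^{n-1}$. If $\lambda>-\frac n2$, then the function $r\mapsto(1-r)^{n+2\lambda}U(r\zeta)$ is decreasing for $0\le r<1$. If $\lambda<-\frac n2$, then this function is increasing for $0\le r<1$.
   Context: $B^n=\{x\in\mathbb{R}^n:|x|<1\}$, $S^{n-1}=\partial B^n$. "Decreasing" and "increasing" are meant in the weak (non-strict) sense. *)

theory Defs
  imports "HOL-Analysis.Analysis"
begin

text \<open>
  A positive Borel measure on the unit sphere. A value of type \<open>'a measure\<close> is always nonnegative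
  and countably additive, so only the sigma-algebra has to be prescribed; it also fixes the
  underlying space to be the sphere.
\<close>

definition borel_measure_on_sphere :: "(real ^ 'n) measure \<Rightarrow> bool" where
  "borel_measure_on_sphere \<mu> \<longleftrightarrow> sets \<mu> = sets (restrict_space borel (sphere 0 1))"

text \<open>
  The integrand is nonnegative, so the potential is defined with values in \<open>[0, \<infinity>]\<close>;
  its finiteness in the ball is a separate hypothesis.
\<close>

definition sphere_potential :: "real \<Rightarrow> (real ^ 'n) measure \<Rightarrow> real ^ 'n \<Rightarrow> ennreal" where
  "sphere_potential l \<mu> x =
     (\<integral>\<^sup>+ \<eta>. ennreal (1 / norm (x - \<eta>) powr (real CARD('n) + 2 * l)) \<partial>\<mu>)"

end

theory Submission
  imports Defs
begin

text \<open>
  The statement already holds for each kernel, that is, before integration. For unit vectors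
  \<open>\<zeta>\<close> and \<open>\<eta>\<close>,
  \<open>|r \<zeta> - \<eta>|\<^sup>2 = (1 - r)\<^sup>2 + r |\<zeta> - \<eta>|\<^sup>2\<close>,
  so \<open>(|r \<zeta> - \<eta>| / (1 - r))\<^sup>2 = 1 + |\<zeta> - \<eta>|\<^sup>2 r / (1 - r)\<^sup>2\<close>
  increases on \<open>[0, 1)\<close>. Hence \<open>(1 - r) / |r \<zeta> - \<eta>|\<close> decreases, its powers with a positive
  exponent \<open>n + 2 \<lambda>\<close> decrease and those with a negative exponent increase. Multiplying the
  potential by \<open>(1 - r)\<close> to the power \<open>n + 2 \<lambda>\<close> turns the integrand into exactly this power, and
  integration against a positive measure preserves the inequality
  (\<open>weighted_potential_mono\<close>).
\<close>

lemma norm_radial_diff_squared: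
  fixes \<zeta> \<eta> :: "'a::real_inner"
  assumes "norm \<zeta> = 1" "norm \<eta> = 1"
  shows "(norm (r *\<^sub>R \<zeta> - \<eta>))\<^sup>2 = (1 - r)\<^sup>2 + r * (norm (\<zeta> - \<eta>))\<^sup>2"
proof -
  have "\<zeta> \<bullet> \<zeta> = 1" "\<eta> \<bullet> \<eta> = 1"
    using assms by (simp_all add: dot_square_norm)
  then show ?thesis
    unfolding power2_norm_eq_inner
    by (simp add: inner_diff_left inner_diff_right inner_commute power2_eq_square algebra_simps)
qed

lemma norm_radial_diff_pos:
  fixes \<zeta> \<eta> :: "'a::real_normed_vector"
  assumes "norm \<zeta> = 1" "norm \<eta> = 1" "0 \<le> r" "r < 1"
  shows "0 < norm (r *\<^sub>R \<zeta> - \<eta>)"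
  using assms by auto

lemma radial_ratio_antimono:
  fixes \<zeta> \<eta> :: "'a::real_inner"
  assumes "norm \<zeta> = 1" "norm \<eta> = 1" "0 \<le> r" "r \<le> s" "s < 1"
  shows "(1 - s) / norm (s *\<^sub>R \<zeta> - \<eta>) \<le> (1 - r) / norm (r *\<^sub>R \<zeta> - \<eta>)"
proof -
  have "r * (1 - s)\<^sup>2 \<le> s * (1 - r)\<^sup>2"
    using assms by (intro mult_mono power_mono) auto
  then have "r * (1 - s)\<^sup>2 * (norm (\<zeta> - \<eta>))\<^sup>2 \<le> s * (1 - r)\<^sup>2 * (norm (\<zeta> - \<eta>))\<^sup>2"
    by (rule mult_right_mono) simp
  then have "((1 - s) * norm (r *\<^sub>R \<zeta> - \<eta>))\<^sup>2 \<le> ((1 - r) * norm (s *\<^sub>R \<zeta> - \<eta>))\<^sup>2"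
    unfolding power_mult_distrib norm_radial_diff_squared[OF assms(1,2)]
    by (simp add: algebra_simps)
  then have "(1 - s) * norm (r *\<^sub>R \<zeta> - \<eta>) \<le> (1 - r) * norm (s *\<^sub>R \<zeta> - \<eta>)"
    using assms by (auto intro: power2_le_imp_le)
  moreover have "0 < norm (r *\<^sub>R \<zeta> - \<eta>)" "0 < norm (s *\<^sub>R \<zeta> - \<eta>)"
    using norm_radial_diff_pos[OF assms(1,2)] assms(3-5) by auto
  ultimately show ?thesis
    by (simp add: divide_le_eq pos_le_divide_eq mult.commute)
qed

text \<open>
  Shared by both signs of the exponent, which differ only in which of two points on a radius has
  the larger weighted kernel. Finiteness matters at \<open>y\<close>, the larger side, because
  \<open>enn2real\<close> sends \<open>\<infinity>\<close> to \<open>0\<close>.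
\<close>

lemma weighted_potential_mono:
  fixes \<mu> :: "(real ^ 'n) measure"
  assumes \<mu>: "borel_measure_on_sphere \<mu>"
    and fin: "sphere_potential l \<mu> y < \<infinity>"
    and nonneg: "0 \<le> a" "0 \<le> b"
    and le: "\<And>\<eta>. norm \<eta> = 1 \<Longrightarrow>
      a * (1 / norm (x - \<eta>) powr (real CARD('n) + 2 * l))
        \<le> b * (1 / norm (y - \<eta>) powr (real CARD('n) + 2 * l))"
  shows "a * enn2real (sphere_potential l \<mu> x) \<le> b * enn2real (sphere_potential l \<mu> y)"
proof -
  let ?K = "\<lambda>z \<eta>. 1 / norm (z - \<eta>) powr (real CARD('n) + 2 * l)"
  have sets: "sets \<mu> = sets (restrict_space borel (sphere 0 1))"
    using \<mu> by (simp add: borel_measure_on_sphere_def)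
  have space: "space \<mu> = sphere 0 1"
    using sets_eq_imp_space_eq[OF sets] by (simp add: space_restrict_space)
  have meas: "(\<lambda>\<eta>. ennreal (?K z \<eta>)) \<in> borel_measurable \<mu>" for z
  proof -
    have "(\<lambda>\<eta>. ennreal (?K z \<eta>)) \<in> borel_measurable borel"
      by measurable
    then have "(\<lambda>\<eta>. ennreal (?K z \<eta>)) \<in> borel_measurable (restrict_space borel (sphere 0 1))"
      by (rule measurable_restrict_space1)
    then show ?thesis
      by (simp add: measurable_cong_sets[OF sets refl])
  qed
  have scale: "ennreal c * sphere_potential l \<mu> z = (\<integral>\<^sup>+ \<eta>. ennreal (c * ?K z \<eta>) \<partial>\<mu>)"
    if "0 \<le> c" for c z
    unfolding sphere_potential_def ennreal_mult'[OF that] nn_integral_cmult[OF meas] ..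
  have "ennreal a * sphere_potential l \<mu> x \<le> ennreal b * sphere_potential l \<mu> y"
    unfolding scale[OF nonneg(1)] scale[OF nonneg(2)]
    by (intro nn_integral_mono ennreal_leI le) (simp add: space)
  moreover have "ennreal b * sphere_potential l \<mu> y < top"
    using fin by (simp add: ennreal_mult_less_top)
  ultimately have "enn2real (ennreal a * sphere_potential l \<mu> x)
      \<le> enn2real (ennreal b * sphere_potential l \<mu> y)"
    by (rule enn2real_mono)
  then show ?thesis
    using nonneg by (simp add: enn2real_mult)
qed

theorem corollary1p3:
  fixes \<mu> :: "(real ^ 'n) measure" and \<zeta> :: "real ^ 'n" and l :: real
    and U :: "real ^ 'n \<Rightarrow> ennreal"
  assumes "CARD('n) \<ge> 2"
    and "borel_measure_on_sphere \<mu>"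
    and "U = sphere_potential l \<mu>"
    and "\<forall>x \<in> ball 0 1. U x < \<infinity>"
    and "\<zeta> \<in> sphere 0 1"
  shows "(l > - real CARD('n) / 2 \<longrightarrow>
            antimono_on {0..<1::real}
              (\<lambda>r. (1 - r) powr (real CARD('n) + 2 * l) * enn2real (U (r *\<^sub>R \<zeta>))))
       \<and> (l < - real CARD('n) / 2 \<longrightarrow>
            mono_on {0..<1::real}
              (\<lambda>r. (1 - r) powr (real CARD('n) + 2 * l) * enn2real (U (r *\<^sub>R \<zeta>))))"
proof -
  let ?p = "real CARD('n) + 2 * l"
  have \<zeta>: "norm \<zeta> = 1"
    using assms(5) by simp
  have fin: "sphere_potential l \<mu> (r *\<^sub>R \<zeta>) < \<infinity>" if "0 \<le> r" "r < 1" for r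
    using assms(3,4) \<zeta> that by auto
  have weighted: "(1 - r) powr ?p * (1 / norm (r *\<^sub>R \<zeta> - \<eta>) powr ?p)
      = ((1 - r) / norm (r *\<^sub>R \<zeta> - \<eta>)) powr ?p" if "r < 1" for r \<eta>
    using that by (simp add: powr_divide)
  have dec: "(1 - s) powr ?p * enn2real (U (s *\<^sub>R \<zeta>)) \<le> (1 - r) powr ?p * enn2real (U (r *\<^sub>R \<zeta>))"
    if "0 < ?p" "0 \<le> r" "r \<le> s" "s < 1" for r s
    unfolding assms(3)
  proof (rule weighted_potential_mono[OF assms(2) fin])
    fix \<eta> :: "real ^ 'n" assume "norm \<eta> = 1"
    then have "((1 - s) / norm (s *\<^sub>R \<zeta> - \<eta>)) powr ?p \<le> ((1 - r) / norm (r *\<^sub>R \<zeta> - \<eta>)) powr ?p"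
      using that by (intro powr_mono2 radial_ratio_antimono \<zeta>) auto
    then show "(1 - s) powr ?p * (1 / norm (s *\<^sub>R \<zeta> - \<eta>) powr ?p)
        \<le> (1 - r) powr ?p * (1 / norm (r *\<^sub>R \<zeta> - \<eta>) powr ?p)"
      using that by (simp only: weighted)
  qed (use that in auto)
  have inc: "(1 - r) powr ?p * enn2real (U (r *\<^sub>R \<zeta>)) \<le> (1 - s) powr ?p * enn2real (U (s *\<^sub>R \<zeta>))"
    if "?p < 0" "0 \<le> r" "r \<le> s" "s < 1" for r s
    unfolding assms(3)
  proof (rule weighted_potential_mono[OF assms(2) fin])
    fix \<eta> :: "real ^ 'n" assume \<eta>: "norm \<eta> = 1"
    \<comment> \<open>A negative power reverses an inequality only if the smaller base is positive.\<close>
    have "0 < (1 - s) / norm (s *\<^sub>R \<zeta> - \<eta>)"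
      using norm_radial_diff_pos[OF \<zeta> \<eta>, of s] that by simp
    then have "((1 - r) / norm (r *\<^sub>R \<zeta> - \<eta>)) powr ?p \<le> ((1 - s) / norm (s *\<^sub>R \<zeta> - \<eta>)) powr ?p"
      using that by (intro powr_mono2' radial_ratio_antimono \<zeta> \<eta>) auto
    then show "(1 - r) powr ?p * (1 / norm (r *\<^sub>R \<zeta> - \<eta>) powr ?p)
        \<le> (1 - s) powr ?p * (1 / norm (s *\<^sub>R \<zeta> - \<eta>) powr ?p)"
      using that by (simp only: weighted)
  qed (use that in auto)
  show ?thesis
    using dec inc by (auto intro!: monotone_onI)
qed

end
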